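(* Let $L>0$. There are a smooth and semibounded $g\colon\mathcal{H}\to\mathcal{H}$ with $|g|_{\mathrm{Lip}}\le L$ and an initial value $u_0\in\mathcal{H}$ with the property that, for every $\Delta t>0$, the application of the three stage, third order explicit method SSPRK(3,3) with step size $\Delta t$ to $\frac{d}{dt}u(t)=g(u(t))$, $u(0)=u_0$, yields a numerical solution $u_{\mathrm{num}}$ such that the sequence $\bigl(\|u_{\mathrm{num}}(n\Delta t)\|^2\bigr)_{n\in\mathbb{N}_0}$ is monotonically increasing and unbounded.
   Context: ODE setting: $\mathcal{H}$ (to be chosen along with $g$) is a real vector space with semi inner product $\langle\cdot,\cdot\rangle$ and induced seminorm $\|\cdot\|$ (e.g. a real Hilbert space such as $\mathbb{R}^2$ with the Euclidean inner product). The function $g$ is semibounded if $\langle u,g(u)\rangle\le 0$ for all $u\in\mathcal{H}$. Its Lipschitz seminorm is $|g|_{\mathrm{Lip}}=\sup_{u\ne v}\|g(u)-g(v)\|/\|u-v\|$. Smooth means infinitely differentiable. The method SSPRK(3,3): one step of size $\Delta t$ from $w_0$ to $w_+$ is $$w_1=w_0,\quad w_2=w_0+\Delta t\,g(w_1),\quad w_3=w_0+\tfrac14\Delta t\,g(w_1)+\tfrac14\Delta t\,g(w_2),$$ $$w_+=w_0+\tfrac16\Delta t\,g(w_1)+\tfrac16\Delta t\,g(w_2)+\tfrac23\Delta t\,g(w_3).$$ The numerical solution is defined by $u_{\mathrm{num}}(0)=u_0$, and $u_{\mathrm{num}}((n+1)\Delta t)$ is the result of one such step started from $w_0=u_{\mathrm{num}}(n\Delta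 t)$. *)

theory Defs
  imports "HOL-Analysis.Analysis"
begin

definition semibounded :: "('a::real_inner \<Rightarrow> 'a) \<Rightarrow> bool"
  where "semibounded g \<longleftrightarrow> (\<forall>u. u \<bullet> g u \<le> 0)"

text \<open>The value \<open>\<infinity>\<close> is attained exactly when \<open>g\<close> is not globally Lipschitz.\<close>

definition lip_seminorm :: "('a::real_normed_vector \<Rightarrow> 'b::real_normed_vector) \<Rightarrow> ereal"
  where "lip_seminorm g = (SUP (u, v)\<in>{(u, v). u \<noteq> v}. ereal (norm (g u - g v) / norm (u - v)))"

text \<open>
  The derivative of order \<open>n + 1\<close> is obtained by differentiating, for every fixed direction \<open>v\<close>,
  the map \<open>x \<mapsto> Df(x)v\<close>. The domain is finite-dimensional, so differentiability of all of
  these maps is the same as differentiability of the operator-valued map \<open>Df\<close>.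
\<close>

primrec times_differentiable ::
  "nat \<Rightarrow> ('a::euclidean_space \<Rightarrow> 'b::real_normed_vector) \<Rightarrow> bool" where
  "times_differentiable 0 f \<longleftrightarrow> True"
| "times_differentiable (Suc n) f \<longleftrightarrow>
     (\<forall>x. f differentiable (at x)) \<and>
     (\<forall>v. times_differentiable n (\<lambda>x. frechet_derivative f (at x) v))"

definition smooth :: "('a::euclidean_space \<Rightarrow> 'b::real_normed_vector) \<Rightarrow> bool"
  where "smooth f \<longleftrightarrow> (\<forall>n. times_differentiable n f)"

definition ssprk33_step :: "real \<Rightarrow> ('a::real_vector \<Rightarrow> 'a) \<Rightarrow> 'a \<Rightarrow> 'a"
  where "ssprk33_step dt g w0 =
    (let w1 = w0;
         w2 = w0 + dt *\<^sub>R g w1;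
         w3 = w0 + (1/4 * dt) *\<^sub>R g w1 + (1/4 * dt) *\<^sub>R g w2
     in w0 + (1/6 * dt) *\<^sub>R g w1 + (1/6 * dt) *\<^sub>R g w2 + (2/3 * dt) *\<^sub>R g w3)"

text \<open>\<open>u_num dt g u0 n\<close> is the numerical solution at time \<open>n * dt\<close>.\<close>

primrec u_num :: "real \<Rightarrow> ('a::real_vector \<Rightarrow> 'a) \<Rightarrow> 'a \<Rightarrow> nat \<Rightarrow> 'a" where
  "u_num dt g u0 0 = u0"
| "u_num dt g u0 (Suc n) = ssprk33_step dt g (u_num dt g u0 n)"

end

theory Submission
  imports Defs
begin

text \<open>
  The field \<open>swirl c u = c / (1 + \<bar>u\<bar>\<^sup>2) \<cdot> J u\<close>, with \<open>J\<close> the rotation by a right angle, is orthogonal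
  to \<open>u\<close>, so that the exact flow turns every point around its circle and conserves the energy
  \<open>\<bar>u\<bar>\<^sup>2\<close>. The angular velocity, however, falls with the radius, and this makes the method gain
  energy. The intermediate stages leave the circle: the second stage lies outside it and moves
  more slowly, whereas the third stage lies inside it and moves faster if the step is small. For a
  linear rotation the energy errors of order up to three cancel and dissipation remains at order
  four; the nonlinear contribution enters at the same order with the opposite sign and outweighs
  it away from the origin.

  That the gain persists for \<^emph>\<open>every\<close> step size comes from an exact computation. Identifying the
  plane with the complex numbers, \<open>J\<close> is multiplication by \<open>\<i>\<close>, every stage is a complex multiple of
  the old value \<open>u\<close>, and the new energy is a function \<open>next_energy k s\<close> of \<open>s = \<bar>u\<bar>\<^sup>2\<close> and
  \<open>k = c \<Delta>t\<close>. After clearing denominators, the gain is a polynomial in one positive variable whose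
  coefficients are all positive as long as \<open>s \<ge> 1\<close> (\<open>growth_polynomial_pos\<close>), so that
  \<open>next_energy k s > s\<close> there. Started on the unit circle, the energies therefore increase
  strictly. If they were bounded, they would converge to a fixed point of the continuous function
  \<open>next_energy k\<close>, but it has none on \<open>[1, \<infinity>)\<close> (\<open>iteration_without_fixed_point\<close>).

  The field is a rational function without poles, hence smooth, and its Lipschitz constant is at
  most \<open>c\<close> because inverse stereographic projection onto a sphere of diameter one does not increase
  distances (\<open>norm_stereographic_diff_le\<close>).
\<close>

section \<open>A calculus for repeated differentiability\<close>

lemma times_differentiable_const [simp]: "times_differentiable n (\<lambda>x. c)"
  by (induction n arbitrary: c) simp_all

lemma times_differentiable_bounded_linear:
  assumes "bounded_linear f"
  shows "times_differentiable n f"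
proof (cases n)
  case (Suc m)
  have "(f has_derivative f) (at x)" for x
    using assms by (rule bounded_linear_imp_has_derivative)
  then have "f differentiable (at x)" "frechet_derivative f (at x) = f" for x
    by (auto simp: differentiable_def intro: frechet_derivative_at[symmetric])
  then show ?thesis using Suc by simp
qed simp

lemma times_differentiable_SucD:
  fixes f :: "'a::euclidean_space \<Rightarrow> 'b::real_normed_vector"
  shows "times_differentiable (Suc n) f \<Longrightarrow> times_differentiable n f"
  by (induction n arbitrary: f) auto

text \<open>
  The inductions below all need the same step: a formula for the directional derivatives reduces
  differentiability of order \<open>n + 1\<close> to order \<open>n\<close>.
\<close>

lemma times_differentiable_SucI:
  assumes "\<And>x. (f has_derivative f' x) (at x)"
    and "\<And>v. times_differentiable n (\<lambda>x. f' x v)"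
  shows "times_differentiable (Suc n) f"
proof -
  have "frechet_derivative f (at x) = f' x" for x
    using frechet_derivative_at[OF assms(1)] by simp
  then show ?thesis
    using assms by (auto simp: differentiable_def)
qed

lemma times_differentiable_Suc_has_derivative:
  assumes "times_differentiable (Suc n) f"
  shows "(f has_derivative frechet_derivative f (at x)) (at x)"
  using assms by (simp add: frechet_derivative_works)

lemma times_differentiable_add:
  assumes "times_differentiable n f" "times_differentiable n g"
  shows "times_differentiable n (\<lambda>x. f x + g x)"
  using assms
proof (induction n arbitrary: f g)
  case (Suc n)
  show ?case
  proof (rule times_differentiable_SucI)
    show "((\<lambda>x. f x + g x) has_derivative
        (\<lambda>v. frechet_derivative f (at x) v + frechet_derivative g (at x) v)) (at x)" for x
      by (intro has_derivative_add times_differentiable_Suc_has_derivative[OF Suc.prems(1)]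
          times_differentiable_Suc_has_derivative[OF Suc.prems(2)])
  qed (use Suc in auto)
qed simp

lemma times_differentiable_bilinear:
  assumes "bounded_bilinear B" "times_differentiable n f" "times_differentiable n g"
  shows "times_differentiable n (\<lambda>x. B (f x) (g x))"
  using assms(2,3)
proof (induction n arbitrary: f g)
  case (Suc n)
  show ?case
  proof (rule times_differentiable_SucI)
    show "((\<lambda>x. B (f x) (g x)) has_derivative
        (\<lambda>v. B (f x) (frechet_derivative g (at x) v) + B (frechet_derivative f (at x) v) (g x)))
        (at x)" for x
      by (intro bounded_bilinear.FDERIV[OF assms(1)]
          times_differentiable_Suc_has_derivative[OF Suc.prems(1)]
          times_differentiable_Suc_has_derivative[OF Suc.prems(2)])
    have "times_differentiable n f" "times_differentiable n g"
      using Suc.prems times_differentiable_SucD by blast+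
    then show "times_differentiable n
        (\<lambda>x. B (f x) (frechet_derivative g (at x) v) + B (frechet_derivative f (at x) v) (g x))" for v
      using Suc by (intro times_differentiable_add Suc.IH) auto
  qed
qed simp

lemma times_differentiable_inverse:
  fixes f :: "'a::euclidean_space \<Rightarrow> real"
  assumes "times_differentiable n f" "\<And>x. f x \<noteq> 0"
  shows "times_differentiable n (\<lambda>x. inverse (f x))"
  using assms(1)
proof (induction n)
  case (Suc n)
  have inv: "times_differentiable n (\<lambda>x. inverse (f x))"
    using Suc times_differentiable_SucD by blast
  show ?case
  proof (rule times_differentiable_SucI)
    show "((\<lambda>x. inverse (f x)) has_derivative
        (\<lambda>v. (- 1) * (inverse (f x) * (frechet_derivative f (at x) v * inverse (f x))))) (at x)" for x
      using Deriv.has_derivative_inverse[OF assms(2) times_differentiable_Suc_has_derivative[OF Suc.prems]]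
      by (simp add: mult.assoc)
    show "times_differentiable n
        (\<lambda>x. (- 1) * (inverse (f x) * (frechet_derivative f (at x) v * inverse (f x))))" for v
      by (intro times_differentiable_bilinear[OF bounded_bilinear_mult] inv times_differentiable_const)
        (use Suc.prems in auto)
  qed
qed simp


section \<open>The rotating field\<close>

definition perp :: "real^2 \<Rightarrow> real^2"
  where "perp u = vector [- u $ 2, u $ 1]"

definition swirl :: "real \<Rightarrow> real^2 \<Rightarrow> real^2"
  where "swirl c u = (c / (1 + (norm u)\<^sup>2)) *\<^sub>R perp u"

lemma bounded_linear_perp: "bounded_linear perp"
  unfolding linear_conv_bounded_linear[symmetric]
  by (auto simp: linear_iff perp_def vec_eq_iff forall_2)

lemmas perp_add = linear_add[OF bounded_linear.linear[OF bounded_linear_perp]]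
  and perp_diff = linear_diff[OF bounded_linear.linear[OF bounded_linear_perp]]
  and perp_scaleR = linear_cmul[OF bounded_linear.linear[OF bounded_linear_perp]]

lemma perp_perp [simp]: "perp (perp u) = - u"
  by (simp add: perp_def vec_eq_iff forall_2)

lemma inner_perp [simp]: "u \<bullet> perp u = 0"
  by (simp add: perp_def inner_vec_def sum_2)

lemma norm_perp [simp]: "norm (perp u) = norm u"
  by (simp add: perp_def norm_eq_sqrt_inner inner_vec_def sum_2)

lemma one_plus_norm_sq_pos: "0 < 1 + (norm u)\<^sup>2"
  by (simp add: add_pos_nonneg)

lemma semibounded_swirl: "semibounded (swirl c)"
  by (simp add: semibounded_def swirl_def)

lemma smooth_swirl: "smooth (swirl c)"
  unfolding smooth_def
proof
  fix n
  have "times_differentiable n (\<lambda>u :: real^2. 1 + u \<bullet> u)"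
    by (intro times_differentiable_add times_differentiable_const
        times_differentiable_bilinear[OF bounded_bilinear_inner]
        times_differentiable_bounded_linear bounded_linear_ident)
  moreover have "1 + u \<bullet> u \<noteq> 0" for u :: "real^2"
    using one_plus_norm_sq_pos[of u] by (simp add: power2_norm_eq_inner)
  ultimately have "times_differentiable n (\<lambda>u :: real^2. (c * inverse (1 + u \<bullet> u)) *\<^sub>R perp u)"
    by (intro times_differentiable_bilinear[OF bounded_bilinear_scaleR]
        times_differentiable_bilinear[OF bounded_bilinear_mult] times_differentiable_inverse
        times_differentiable_bounded_linear[OF bounded_linear_perp] times_differentiable_const)
  also have "(\<lambda>u :: real^2. (c * inverse (1 + u \<bullet> u)) *\<^sub>R perp u) = swirl c"
    by (simp add: fun_eq_iff swirl_def power2_norm_eq_inner divide_inverse)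
  finally show "times_differentiable n (swirl c)" .
qed

text \<open>
  The points \<open>(u / (1 + \<bar>u\<bar>\<^sup>2), 1 / (1 + \<bar>u\<bar>\<^sup>2))\<close> are the images of \<open>u\<close> under inverse stereographic
  projection onto a sphere of diameter one. The squared distance of two images is
  \<open>\<bar>u - v\<bar>\<^sup>2 / ((1 + \<bar>u\<bar>\<^sup>2) (1 + \<bar>v\<bar>\<^sup>2)) \<le> \<bar>u - v\<bar>\<^sup>2\<close>, and dropping the last coordinate can only
  decrease it.
\<close>

lemma norm_stereographic_diff_le:
  fixes u v :: "'a::real_inner"
  shows "norm ((1 / (1 + (norm u)\<^sup>2)) *\<^sub>R u - (1 / (1 + (norm v)\<^sup>2)) *\<^sub>R v) \<le> norm (u - v)"
proof -
  define U V where "U = 1 + (norm u)\<^sup>2" and "V = 1 + (norm v)\<^sup>2"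
  have U: "U \<ge> 1" and V: "V \<ge> 1" by (simp_all add: U_def V_def)
  have uu: "u \<bullet> u = U - 1" and vv: "v \<bullet> v = V - 1"
    by (simp_all add: U_def V_def power2_norm_eq_inner)
  have "(norm ((1 / U) *\<^sub>R u - (1 / V) *\<^sub>R v))\<^sup>2 + (1 / U - 1 / V)\<^sup>2 = (norm (u - v))\<^sup>2 / (U * V)"
    unfolding power2_norm_eq_inner using U V
    by (simp add: inner_diff uu vv inner_commute[of v u] field_simps power2_eq_square)
  also have "\<dots> \<le> (norm (u - v))\<^sup>2"
    using mult_mono[OF U V] U V by (simp add: divide_le_eq mult_le_cancel_left1)
  finally have "(norm ((1 / U) *\<^sub>R u - (1 / V) *\<^sub>R v))\<^sup>2 \<le> (norm (u - v))\<^sup>2"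
    using zero_le_power2[of "1 / U - 1 / V"] by linarith
  then show ?thesis
    unfolding U_def V_def by (rule power2_le_imp_le) simp
qed

lemma norm_swirl_diff_le:
  assumes "0 \<le> c"
  shows "norm (swirl c u - swirl c v) \<le> c * norm (u - v)"
proof -
  have "swirl c u - swirl c v
      = c *\<^sub>R perp ((1 / (1 + (norm u)\<^sup>2)) *\<^sub>R u - (1 / (1 + (norm v)\<^sup>2)) *\<^sub>R v)"
    by (simp add: swirl_def perp_diff perp_scaleR scaleR_diff_right)
  then show ?thesis
    using mult_left_mono[OF norm_stereographic_diff_le assms] assms by simp
qed

lemma lip_seminorm_swirl_le:
  assumes "0 \<le> c"
  shows "lip_seminorm (swirl c) \<le> ereal c"
  unfolding lip_seminorm_def
  using norm_swirl_diff_le[OF assms] by (auto intro!: SUP_least simp: divide_le_eq)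


section \<open>The energy after one step\<close>

text \<open>
  The angles \<open>a\<close>, \<open>b\<close>, \<open>e\<close> are the angular velocities at the three stages, multiplied by the step
  size. The moduli of the complex factors \<open>1 + \<i> a\<close> and \<open>1 - a b / 4 + \<i> (a + b) / 4\<close> give the
  energies of the second and third stage.
\<close>

definition angle1 :: "real \<Rightarrow> real \<Rightarrow> real"
  where "angle1 k s = k / (1 + s)"

definition angle2 :: "real \<Rightarrow> real \<Rightarrow> real"
  where "angle2 k s = k / (1 + (1 + (angle1 k s)\<^sup>2) * s)"

definition angle3 :: "real \<Rightarrow> real \<Rightarrow> real"
  where "angle3 k s = (let a = angle1 k s; b = angle2 k s
    in k / (1 + ((1 - a * b / 4)\<^sup>2 + ((a + b) / 4)\<^sup>2) * s))"

definition next_energy :: "real \<Rightarrow> real \<Rightarrow> real"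
  where "next_energy k s = (let a = angle1 k s; b = angle2 k s; e = angle3 k s
    in ((1 - (a * b + b * e + e * a) / 6)\<^sup>2 + ((a + b + 4 * e - a * b * e) / 6)\<^sup>2) * s)"

lemma norm_sq_scaleR_add_perp:
  "(norm (p *\<^sub>R u + q *\<^sub>R perp u))\<^sup>2 = (p\<^sup>2 + q\<^sup>2) * (norm u)\<^sup>2"
proof -
  have "perp u \<bullet> perp u = u \<bullet> u"
    by (metis norm_perp power2_norm_eq_inner)
  then show ?thesis
    unfolding power2_norm_eq_inner
    by (simp add: inner_add inner_commute[of "perp u" u] algebra_simps power2_eq_square)
qed

text \<open>The complex multiples of \<open>u\<close> are mapped to complex multiples of \<open>u\<close>; hence a step of the method
  is an operation on the two coefficients.\<close>

lemma scaleR_swirl_scaleR_add_perp: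
  "dt *\<^sub>R swirl c (p *\<^sub>R u + q *\<^sub>R perp u)
    = (let d = dt * c / (1 + (p\<^sup>2 + q\<^sup>2) * (norm u)\<^sup>2) in (- d * q) *\<^sub>R u + (d * p) *\<^sub>R perp u)"
  by (simp add: swirl_def norm_sq_scaleR_add_perp perp_add perp_scaleR Let_def algebra_simps)

lemma norm_sq_ssprk33_step_swirl:
  "(norm (ssprk33_step dt (swirl c) u))\<^sup>2 = next_energy (dt * c) ((norm u)\<^sup>2)"
proof -
  define s where "s = (norm u)\<^sup>2"
  define a where "a = angle1 (dt * c) s"
  define b where "b = angle2 (dt * c) s"
  define e where "e = angle3 (dt * c) s"
  \<comment> \<open>\<open>w p q\<close> is the complex number \<open>p + \<i> q\<close> times \<open>u\<close>.\<close>
  define w where "w p q = p *\<^sub>R u + q *\<^sub>R perp u" for p q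
  have w_add: "w p q + w p' q' = w (p + p') (q + q')"
    and w_scaleR: "r *\<^sub>R w p q = w (r * p) (r * q)" for p q p' q' r
    by (simp_all add: w_def algebra_simps)
  have field: "dt *\<^sub>R swirl c (w p q) = w (- d * q) (d * p)"
    if "dt * c / (1 + (p\<^sup>2 + q\<^sup>2) * s) = d" for p q d
    using that scaleR_swirl_scaleR_add_perp[of dt c p u q] unfolding w_def s_def Let_def by simp
  have u: "u = w 1 0" by (simp add: w_def)
  have f1: "dt *\<^sub>R swirl c u = w 0 a"
    using field[of 1 0 a] u by (simp add: a_def angle1_def)
  have w2: "u + dt *\<^sub>R swirl c u = w 1 a"
    unfolding f1 by (simp add: u w_add)
  have f2: "dt *\<^sub>R swirl c (w 1 a) = w (- b * a) b"
    using field[of 1 a b] by (simp add: b_def angle2_def a_def)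
  have w3: "u + (1/4 * dt) *\<^sub>R swirl c u + (1/4 * dt) *\<^sub>R swirl c (w 1 a)
      = w (1 - a * b / 4) ((a + b) / 4)"
    unfolding scaleR_scaleR[symmetric] f1 f2
    by (simp add: u w_add w_scaleR add_divide_distrib mult.commute)
  have f3: "dt *\<^sub>R swirl c (w (1 - a * b / 4) ((a + b) / 4))
      = w (- e * ((a + b) / 4)) (e * (1 - a * b / 4))"
    by (rule field) (simp add: e_def angle3_def a_def b_def Let_def)
  have "ssprk33_step dt (swirl c) u
      = w (1 - (a * b + b * e + e * a) / 6) ((a + b + 4 * e - a * b * e) / 6)"
    unfolding ssprk33_step_def Let_def w2 w3
    unfolding scaleR_scaleR[symmetric] f1 f2 f3
    by (simp add: u w_add w_scaleR) (rule arg_cong2[of _ _ _ _ w]; simp add: field_simps)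
  then show ?thesis
    by (simp add: next_energy_def Let_def w_def norm_sq_scaleR_add_perp a_def b_def e_def s_def)
qed


section \<open>Positivity of the energy gain\<close>

text \<open>
  Up to the positive factor \<open>a\<^sup>2 / (36 D\<^sup>2 Q\<^sup>2)\<close>, this expression is the relative energy gain of a
  step, where \<open>a\<close> is the angle of the first stage, \<open>D = a / b\<close> its ratio to the angle of the second
  stage, and \<open>Q = 16 D\<^sup>2 a / e\<close> comes from the third. In its expansion in powers of \<open>y\<close> every
  coefficient is positive for \<open>1 \<le> \<kappa> \<le> 2\<close>: already the part
  of degree at most one in \<open>\<kappa>\<close> is.
\<close>

lemma growth_polynomial_pos:
  fixes y \<kappa> :: real
  assumes "0 < y" "1 \<le> \<kappa>" "\<kappa> \<le> 2"
  defines "D \<equiv> 1 + y" and "Q \<equiv> 16 + 28 * y + (12 + \<kappa>) * y^2 + y^3"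
  shows "0 < Q^2 * (D^2 + 1 - 10 * D + \<kappa> * y) + 64 * D^3 * (64 * D^3 - D * Q - Q)
    + 256 * \<kappa> * y * D^4 * (D^2 - 6 * D + 1 + \<kappa> * y)" (is "0 < ?N")
proof -
  have "?N = y * (4608 - 768 * \<kappa>)
      + y^2 * (21888 - 4608 * \<kappa> + 256 * \<kappa>^2)
      + y^3 * (41088 - 9968 * \<kappa> + 1056 * \<kappa>^2)
      + y^4 * (38032 - 9696 * \<kappa> + 1584 * \<kappa>^2)
      + y^5 * (17280 - 3856 * \<kappa> + 1040 * \<kappa>^2 + \<kappa>^3)
      + y^6 * (3008 - 32 * \<kappa> + 259 * \<kappa>^2)
      + y^7 * (259 * \<kappa> - 48)
      + y^8"
    unfolding D_def Q_def by algebra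
  also have "\<dots> > 0"
    using assms(1-3) by (intro add_pos_pos mult_pos_pos zero_less_power add_pos_nonneg) auto
  finally show ?thesis .
qed

text \<open>
  The variables \<open>\<kappa> = 1 + 1 / s\<close> and \<open>y = a\<^sup>2 / \<kappa>\<close> keep the polynomials small: the ratio of the first
  two angles is simply \<open>1 + y\<close>, and \<open>\<kappa>\<close> enters the denominator \<open>Q\<close> of the third angle only linearly.
  The condition \<open>s \<ge> 1\<close> becomes \<open>\<kappa> \<le> 2\<close>.
\<close>

lemma next_energy_gt:
  assumes "0 < k" "1 \<le> s"
  shows "s < next_energy k s"
proof -
  define a where "a = angle1 k s"
  define b where "b = angle2 k s"
  define e where "e = angle3 k s"
  define \<kappa> where "\<kappa> = 1 + 1 / s"
  define y where "y = a^2 / \<kappa>"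
  define D where "D = 1 + y"
  define Q where "Q = 16 + 28 * y + (12 + \<kappa>) * y^2 + y^3"
  have \<kappa>: "1 \<le> \<kappa>" "\<kappa> \<le> 2" and s: "1 + s = s * \<kappa>" "s > 0"
    using assms by (auto simp: \<kappa>_def field_simps)
  have a: "a > 0" and k: "k = a * (s * \<kappa>)"
    using assms s \<kappa> unfolding a_def angle1_def by (auto simp: s(1))
  have a2: "a^2 = \<kappa> * y" and y: "y > 0"
    using \<kappa> a by (auto simp: y_def)
  have D: "D > 1" and Q: "Q > 0"
    using y \<kappa> by (auto simp: D_def Q_def intro!: add_pos_pos mult_pos_pos)
  have "1 + (1 + a^2) * s = s * \<kappa> * D"
    using s(1) by (simp add: a2 D_def algebra_simps)
  then have b: "b = a / D"
    using s \<kappa> D unfolding b_def angle2_def a_def[symmetric] by (simp add: k)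
  \<comment> \<open>\<open>Q\<close> arises from the energy of the third stage after multiplication by \<open>16 D\<^sup>2\<close>.\<close>
  have "s * \<kappa> * Q = 16 * D^2 + ((4 * D - \<kappa> * y)^2 + \<kappa> * y * (D + 1)^2) * s"
    using s(1) unfolding D_def Q_def by algebra
  also have "\<dots> = 16 * D^2 + ((4 * D - a^2)^2 + a^2 * (D + 1)^2) * s"
    by (simp only: a2)
  also have "\<dots> = 16 * D^2 * (1 + ((1 - a * b / 4)^2 + ((a + b) / 4)^2) * s)"
    using D unfolding b by (simp add: field_simps) algebra
  finally have "1 + ((1 - a * b / 4)^2 + ((a + b) / 4)^2) * s = s * \<kappa> * Q / (16 * D^2)"
    using D by (simp add: field_simps)
  then have e: "e = 16 * a * D^2 / Q"
    using s \<kappa> D unfolding e_def angle3_def Let_def a_def[symmetric] b_def[symmetric]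
    by (simp add: k power2_eq_square)
  have gain: "0 < Q^2 * (D^2 + 1 - 10 * D + a^2) + 64 * D^3 * (64 * D^3 - D * Q - Q)
        + 256 * a^2 * D^4 * (D^2 - 6 * D + 1 + a^2)"
    using growth_polynomial_pos[OF y \<kappa>] by (simp only: a2 D_def Q_def mult.assoc)
  define p where "p = 1 - (a * b + b * e + e * a) / 6"
  define q where "q = (a + b + 4 * e - a * b * e) / 6"
  have p: "6 * (D * Q) * p = 6 * (D * Q) - a^2 * (Q + 16 * D^2 + 16 * D^3)"
    using D Q unfolding p_def b e by (simp add: field_simps power2_eq_square power3_eq_cube)
  have q: "6 * (D * Q) * q = a * (D * Q + Q + 64 * D^3 - 16 * a^2 * D^2)"
    using D Q unfolding q_def b e by (simp add: field_simps power2_eq_square power3_eq_cube)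
  have "36 * (D * Q)^2 * (p^2 + q^2 - 1)
      = (6 * (D * Q) * p)^2 + (6 * (D * Q) * q)^2 - 36 * (D * Q)^2"
    by algebra
  also have "\<dots> = a^2 * (Q^2 * (D^2 + 1 - 10 * D + a^2) + 64 * D^3 * (64 * D^3 - D * Q - Q)
        + 256 * a^2 * D^4 * (D^2 - 6 * D + 1 + a^2))"
    unfolding p q by algebra
  also have "\<dots> > 0"
    using gain a by (intro mult_pos_pos) auto
  finally have "1 < p^2 + q^2"
    using D Q by (simp add: zero_less_mult_iff)
  then show ?thesis
    using s(2) by (simp add: next_energy_def Let_def a_def b_def e_def p_def q_def)
qed

lemma continuous_on_next_energy: "continuous_on {1..} (next_energy k)"
proof -
  have pos: "1 + (p\<^sup>2 + q\<^sup>2) * s \<noteq> 0" if "1 \<le> s" for p q s :: real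
    using that by (smt (verit) mult_nonneg_nonneg zero_le_power2)
  have a: "continuous_on {1..} (angle1 k)"
    unfolding angle1_def by (intro continuous_intros) auto
  have b: "continuous_on {1..} (angle2 k)"
    unfolding angle2_def by (intro continuous_intros a) (use pos[of _ 1] in auto)
  have e: "continuous_on {1..} (angle3 k)"
    unfolding angle3_def Let_def by (intro continuous_intros a b) (use pos in auto)
  show ?thesis
    unfolding next_energy_def Let_def by (intro continuous_intros a b e) auto
qed


section \<open>Growth without bound\<close>

lemma iteration_without_fixed_point:
  fixes F :: "real \<Rightarrow> real"
  assumes cont: "continuous_on {m..} F" and gt: "\<And>s. m \<le> s \<Longrightarrow> s < F s"
    and start: "m \<le> S 0" and step: "\<And>n. S (Suc n) = F (S n)"
  shows "incseq S" "\<not> bounded (range S)"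
proof -
  have ge: "m \<le> S n" for n
  proof (induction n)
    case (Suc n)
    then show ?case using gt[OF Suc] step[of n] by linarith
  qed (rule start)
  show inc: "incseq S"
    using gt[OF ge] step by (auto intro!: incseq_SucI less_imp_le)
  show "\<not> bounded (range S)"
  proof
    assume "bounded (range S)"
    then have "bdd_above (range S)" by (rule bounded_imp_bdd_above)
    then obtain l where l: "S \<longlonglongrightarrow> l"
      using LIMSEQ_incseq_SUP inc by blast
    have "m \<le> l"
      using ge by (intro LIMSEQ_le_const[OF l]) auto
    then have "(\<lambda>n. F (S n)) \<longlonglongrightarrow> F l"
      using ge by (intro continuous_on_tendsto_compose[OF cont l]) auto
    then have "F l = l"
      using LIMSEQ_Suc[OF l] LIMSEQ_unique unfolding step by blast
    then show False using gt[OF \<open>m \<le> l\<close>] by simp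
  qed
qed

theorem theorem5p1:
  fixes L :: real
  assumes "L > 0"
  shows "\<exists>(g :: real^2 \<Rightarrow> real^2) (u0 :: real^2).
           smooth g \<and> semibounded g \<and> lip_seminorm g \<le> ereal L \<and>
           (\<forall>dt>0. incseq (\<lambda>n. (norm (u_num dt g u0 n))\<^sup>2) \<and>
                   \<not> bounded (range (\<lambda>n. (norm (u_num dt g u0 n))\<^sup>2)))"
proof (intro exI conjI allI impI)
  let ?u0 = "axis 1 1 :: real^2"
  show "smooth (swirl L)" "semibounded (swirl L)" "lip_seminorm (swirl L) \<le> ereal L"
    using assms by (simp_all add: smooth_swirl semibounded_swirl lip_seminorm_swirl_le)
  fix dt :: real
  assume "dt > 0"
  then have gt: "s < next_energy (dt * L) s" if "1 \<le> s" for s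
    using that assms by (simp add: next_energy_gt)
  let ?S = "\<lambda>n. (norm (u_num dt (swirl L) ?u0 n))\<^sup>2"
  have start: "1 \<le> ?S 0" by (simp add: norm_axis_1)
  have step: "?S (Suc n) = next_energy (dt * L) (?S n)" for n
    by (simp add: norm_sq_ssprk33_step_swirl)
  show "incseq ?S" "\<not> bounded (range ?S)"
    using iteration_without_fixed_point[OF continuous_on_next_energy gt, of ?S] start step by blast+
qed

end
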